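(* (a) For $n\ge 4$, $\chi'_L(W_n)=n$. (b) For $n\ge 4$, $\chi'_L(F_n)=n$; moreover $\chi'_L(F_2)=3$ and $\chi'_L(F_3)=4$. (c) For $n\ge 3$, $\chi'_L(Wm(n))=2n$, and $\chi'_L(Wm(2))=5$. (d) For $n\ge 3$, $\chi'_L(B_n)=2n+2$, and $\chi'_L(B_2)=6$.
   Context: For graphs $G,H$, the join $G+H$ is obtained from disjoint copies of $G$ and $H$ by joining every vertex of $G$ to every vertex of $H$. $C_n$ and $P_n$ denote the cycle and path on $n$ vertices, and $nK_2$ the disjoint union of $n$ edges. The wheel is $W_n=K_1+C_n$, the fan is $F_n=K_1+P_n$, the windmill is $Wm(n)=K_1+nK_2$ (a center adjacent to $2n$ vertices $v_1,\dots,v_{2n}$, with edges $v_{2i-1}v_{2i}$), and the book is $B_n=K_2+nK_2$. For a proper edge coloring $c:E(G)\to\{1,\dots,k\}$ of a connected graph $G$, let $\pi=(\mathcal{C}_1,\dots,\mathcal{C}_k)$ be the ordered partition of $E(G)$ into color classes. For a vertex $v$ and an edge $e=xy$, $d(v,e)=\min\{d(v,x),d(v,y)\}$, and $d(v,\mathcal{C}_i)=\min\{d(v,e): e\in\mathcal{C}_i\}$. The edge color code of $v$ is $c_\pi(v)=(d(v,\mathcal{C}_1),\dots,d(v,\mathcal{C}_k))$. The coloring is an edge-locating coloring if distinct vertices have distinct edge color codes; $\chi'_L(G)$ is the minimum number of colors in an edge-locating coloring of $G$. *)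

theory Defs
  imports "HOL-Library.Extended_Nat"
begin

text \<open>An edge is the two-element set of its endpoints.\<close>

datatype 'a graph = Graph (verts: "'a set") (edges: "'a set set")

definition complete_graph :: "nat \<Rightarrow> nat graph" where
  "complete_graph n = Graph {..<n} {{i, j} | i j. i < n \<and> j < n \<and> i \<noteq> j}"

definition path_graph :: "nat \<Rightarrow> nat graph" where
  "path_graph n = Graph {..<n} {{i, i + 1} | i. i + 1 < n}"

text \<open>A cycle only for \<open>n \<ge> 3\<close>.\<close>

definition cycle_graph :: "nat \<Rightarrow> nat graph" where
  "cycle_graph n = Graph {..<n} {{i, (i + 1) mod n} | i. i < n}"

text \<open>The disjoint union of \<open>n\<close> copies of \<open>G\<close>; the first component numbers the copies.\<close>

definition copies :: "nat \<Rightarrow> 'a graph \<Rightarrow> (nat \<times> 'a) graph" where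
  "copies n G = Graph ({..<n} \<times> verts G) {Pair i ` e | i e. i < n \<and> e \<in> edges G}"

definition join :: "'a graph \<Rightarrow> 'b graph \<Rightarrow> ('a + 'b) graph" where
  "join G H = Graph (verts G <+> verts H)
     ((`) Inl ` edges G \<union> (`) Inr ` edges H \<union>
      {{Inl x, Inr y} | x y. x \<in> verts G \<and> y \<in> verts H})"

definition wheel :: "nat \<Rightarrow> (nat + nat) graph" where
  "wheel n = join (complete_graph 1) (cycle_graph n)"

definition fan :: "nat \<Rightarrow> (nat + nat) graph" where
  "fan n = join (complete_graph 1) (path_graph n)"

definition windmill :: "nat \<Rightarrow> (nat + nat \<times> nat) graph" where
  "windmill n = join (complete_graph 1) (copies n (complete_graph 2))"

definition book :: "nat \<Rightarrow> (nat + nat \<times> nat) graph" where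
  "book n = join (complete_graph 2) (copies n (complete_graph 2))"

text \<open>The least length of a walk; vertices in different components have distance \<open>\<infinity>\<close>.\<close>

definition graph_dist :: "'a graph \<Rightarrow> 'a \<Rightarrow> 'a \<Rightarrow> enat" where
  "graph_dist G u v = (INF n\<in>{n. (u, v) \<in> {(x, y). {x, y} \<in> edges G} ^^ n}. enat n)"

definition edge_dist :: "'a graph \<Rightarrow> 'a \<Rightarrow> 'a set \<Rightarrow> enat" where
  "edge_dist G v e = (INF x\<in>e. graph_dist G v x)"

definition class_dist :: "'a graph \<Rightarrow> 'a \<Rightarrow> 'a set set \<Rightarrow> enat" where
  "class_dist G v C = (INF e\<in>C. edge_dist G v e)"

text \<open>The color classes form an ordered partition of the edge set, so none of them is empty;
  hence \<open>c\<close> is onto \<open>{1..k}\<close>.\<close>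

definition proper_edge_coloring :: "'a graph \<Rightarrow> nat \<Rightarrow> ('a set \<Rightarrow> nat) \<Rightarrow> bool" where
  "proper_edge_coloring G k c \<longleftrightarrow>
     c ` edges G = {1..k} \<and>
     (\<forall>e\<in>edges G. \<forall>f\<in>edges G. e \<noteq> f \<and> e \<inter> f \<noteq> {} \<longrightarrow> c e \<noteq> c f)"

definition color_class :: "'a graph \<Rightarrow> ('a set \<Rightarrow> nat) \<Rightarrow> nat \<Rightarrow> 'a set set" where
  "color_class G c i = {e \<in> edges G. c e = i}"

definition edge_color_code :: "'a graph \<Rightarrow> nat \<Rightarrow> ('a set \<Rightarrow> nat) \<Rightarrow> 'a \<Rightarrow> enat list" where
  "edge_color_code G k c v = map (\<lambda>i. class_dist G v (color_class G c i)) [1..<Suc k]"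

definition edge_locating_coloring :: "'a graph \<Rightarrow> nat \<Rightarrow> ('a set \<Rightarrow> nat) \<Rightarrow> bool" where
  "edge_locating_coloring G k c \<longleftrightarrow>
     proper_edge_coloring G k c \<and> inj_on (edge_color_code G k c) (verts G)"

text \<open>The value is \<open>\<infinity>\<close> when \<open>G\<close> has no edge-locating coloring, so an equation
  with a finite right-hand side asserts that the minimum is attained.\<close>

definition edge_locating_chromatic_number :: "'a graph \<Rightarrow> enat" where
  "edge_locating_chromatic_number G = (INF k\<in>{k. \<exists>c. edge_locating_coloring G k c}. enat k)"

end

theory Submission
  imports Defs
begin

text \<open>
  A code has entry 0 at the colors met by the vertex and nowhere else, so a proper coloring in which
  distinct vertices meet distinct sets of colors is edge-locating; this gives all upper bounds.
  The lower bounds come from the maximum degree \<open>d\<close>: with \<open>d\<close> colors, all vertices of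
  degree \<open>d\<close> have the code \<open>(0, \<dots>, 0)\<close>, so there is only one of them.  The one
  remaining case is the windmill on two blades with four colors.  There each blade must reuse the
  color of a spoke of the other blade, and the ends of these two spokes meet the same colors.  Since
  the center meets every color and is adjacent to both ends, all other entries of their codes
  are 1, and the codes agree.
\<close>

section \<open>Codes and the colors met by a vertex\<close>

definition neighbors :: "'a graph \<Rightarrow> 'a \<Rightarrow> 'a set" where
  "neighbors G v = {w. {v, w} \<in> edges G}"

definition colors_at :: "'a graph \<Rightarrow> ('a set \<Rightarrow> nat) \<Rightarrow> 'a \<Rightarrow> nat set" where
  "colors_at G c v = c ` {e \<in> edges G. v \<in> e}"

text \<open>As 0 is the only extended natural below 1, vanishing is a strict upper bound, and an
  infimum lies strictly below a bound only if some member does. The empty family has infimum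
  \<open>\<infinity>\<close>, so it fits too.\<close>

lemma INF_enat_eq_0_iff: "(INF x\<in>A. f x) = (0::enat) \<longleftrightarrow> (\<exists>x\<in>A. f x = 0)"
proof -
  have *: "y = 0 \<longleftrightarrow> y < 1" for y :: enat
    by (cases y) (auto simp: zero_enat_def one_enat_def)
  show ?thesis
    unfolding * by (simp add: INF_less_iff)
qed

lemma graph_dist_eq_0_iff: "graph_dist G u v = 0 \<longleftrightarrow> u = v"
  unfolding graph_dist_def by (auto simp: INF_enat_eq_0_iff enat_0_iff)

text \<open>A zero passes through the three nested infima: it needs an edge of color
  \<open>i\<close>, an endpoint of that edge, and a walk of length 0 from \<open>v\<close> to
  it.\<close>

lemma class_dist_eq_0_iff:
  "class_dist G v (color_class G c i) = 0 \<longleftrightarrow> i \<in> colors_at G c v"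
  by (auto simp: class_dist_def edge_dist_def INF_enat_eq_0_iff graph_dist_eq_0_iff
      color_class_def colors_at_def)

lemma graph_dist_neighbor_le: "w \<in> neighbors G v \<Longrightarrow> graph_dist G v w \<le> 1"
  unfolding graph_dist_def one_enat_def neighbors_def
  by (rule INF_lower) (simp del: One_nat_def add: relpow_1)

lemma class_dist_neighbor_le:
  assumes "w \<in> neighbors G v" "i \<in> colors_at G c w"
  shows "class_dist G v (color_class G c i) \<le> 1"
proof -
  obtain e where e: "e \<in> edges G" "w \<in> e" "c e = i"
    using assms(2) by (auto simp: colors_at_def)
  have "class_dist G v (color_class G c i) \<le> edge_dist G v e"
    unfolding class_dist_def by (rule INF_lower) (use e in \<open>auto simp: color_class_def\<close>)
  also have "\<dots> \<le> graph_dist G v w"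
    unfolding edge_dist_def by (rule INF_lower) (use e in auto)
  also have "\<dots> \<le> 1"
    using assms(1) by (rule graph_dist_neighbor_le)
  finally show ?thesis .
qed

lemma edge_color_code_eq_iff:
  "edge_color_code G k c u = edge_color_code G k c v \<longleftrightarrow>
     (\<forall>i\<in>{1..k}. class_dist G u (color_class G c i) = class_dist G v (color_class G c i))"
  by (simp add: edge_color_code_def atLeastLessThanSuc_atLeastAtMost del: upt_Suc)

lemma colors_at_subset: "proper_edge_coloring G k c \<Longrightarrow> colors_at G c v \<subseteq> {1..k}"
  by (auto simp: proper_edge_coloring_def colors_at_def)

text \<open>The zero entries of a code name the colors met. A proper coloring takes values in
  \<open>{1..k}\<close> only, so no color escapes the code.\<close>

lemma edge_color_code_eq_imp_colors_at_eq:
  assumes "proper_edge_coloring G k c" "edge_color_code G k c u = edge_color_code G k c v"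
  shows "colors_at G c u = colors_at G c v"
proof -
  have "i \<in> colors_at G c u \<longleftrightarrow> i \<in> colors_at G c v" if "i \<in> {1..k}" for i
    using assms(2) that by (metis class_dist_eq_0_iff edge_color_code_eq_iff)
  then show ?thesis
    using colors_at_subset[OF assms(1)] by blast
qed

lemma colors_at_full_imp_code_eq:
  assumes "{1..k} \<subseteq> colors_at G c u" "{1..k} \<subseteq> colors_at G c v"
  shows "edge_color_code G k c u = edge_color_code G k c v"
proof -
  have "class_dist G x (color_class G c i) = 0" if "{1..k} \<subseteq> colors_at G c x" "i \<in> {1..k}" for x i
    using subsetD[OF that] by (simp add: class_dist_eq_0_iff)
  then show ?thesis
    using assms by (simp add: edge_color_code_eq_iff)
qed

text \<open>Each color occurs on an edge at the common neighbor \<open>z\<close>, so every entry of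
  both codes is 0 or 1, and such a code is determined by the positions of its zeros.\<close>

lemma colors_at_eq_imp_code_eq:
  assumes "z \<in> neighbors G u" "z \<in> neighbors G v" "{1..k} \<subseteq> colors_at G c z"
    and "colors_at G c u = colors_at G c v"
  shows "edge_color_code G k c u = edge_color_code G k c v"
proof -
  have *: "d = 0 \<or> d = 1" if "d \<le> 1" for d :: enat
    using that by (metis i0_lb ileI1 linorder_not_le one_eSuc order_antisym)
  have "class_dist G u (color_class G c i) = class_dist G v (color_class G c i)" if "i \<in> {1..k}" for i
    using *[OF class_dist_neighbor_le[OF assms(1), of i c]]
      *[OF class_dist_neighbor_le[OF assms(2), of i c]] assms(3,4) that
    by (metis class_dist_eq_0_iff subsetD)
  then show ?thesis
    by (simp add: edge_color_code_eq_iff)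
qed

section \<open>Colorings given by functions on adjacent pairs\<close>

lemma colors_at_eq:
  assumes "\<And>e. e \<in> edges G \<Longrightarrow> \<exists>x y. e = {x, y}"
  shows "colors_at G c v = (\<lambda>w. c {v, w}) ` neighbors G v"
proof -
  have "\<exists>w. e = {v, w}" if "e \<in> edges G" "v \<in> e" for e
    using assms[OF that(1)] that(2) by auto
  then show ?thesis
    by (fastforce simp: colors_at_def neighbors_def)
qed

text \<open>Concrete colorings are easiest to write as functions of two endpoints by cases on the
  kind of vertex. Symmetry on adjacent pairs lets \<open>f\<close> descend to edges, and
  \<open>distinct\<close> asks only that the zero sets of the codes differ.\<close>

lemma edge_locating_coloring_exists:
  fixes f :: "'a \<Rightarrow> 'a \<Rightarrow> nat"
  assumes pairs: "\<And>e. e \<in> edges G \<Longrightarrow> \<exists>x y. e = {x, y}"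
    and sym: "\<And>x y. y \<in> neighbors G x \<Longrightarrow> f x y = f y x"
    and range: "\<And>x y. y \<in> neighbors G x \<Longrightarrow> f x y \<in> {1..k}"
    and onto: "\<And>m. m \<in> {1..k} \<Longrightarrow> \<exists>x. \<exists>y \<in> neighbors G x. f x y = m"
    and proper: "\<And>x. inj_on (f x) (neighbors G x)"
    and distinct: "inj_on (\<lambda>x. f x ` neighbors G x) (verts G)"
  shows "\<exists>c. edge_locating_coloring G k c"
proof -
  \<comment> \<open>An edge has at most two orderings of its endpoints, and by \<open>sym\<close>
    both give the same value, so the description is unique on edges.\<close>
  define c where "c e = (THE m. \<exists>x y. e = {x, y} \<and> m = f x y)" for e
  have c: "c {x, y} = f x y" if "{x, y} \<in> edges G" for x y
    unfolding c_def using that sym[of y x]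
    by (intro the_equality) (auto simp: doubleton_eq_iff neighbors_def)
  have "c ` edges G = {1..k}"
  proof (intro subset_antisym subsetI)
    fix m assume "m \<in> c ` edges G"
    then obtain e where "e \<in> edges G" "m = c e"
      by blast
    moreover from this pairs[of e] obtain x y where "e = {x, y}"
      by blast
    ultimately show "m \<in> {1..k}"
      using c[of x y] range[of y x] by (simp add: neighbors_def)
  next
    fix m assume "m \<in> {1..k}"
    then obtain x y where "{x, y} \<in> edges G" "f x y = m"
      using onto[of m] by (auto simp: neighbors_def)
    then show "m \<in> c ` edges G"
      using c[of x y] by (auto intro!: image_eqI[of _ _ "{x, y}"])
  qed
  moreover have "c e \<noteq> c e'" if e: "e \<in> edges G" "e' \<in> edges G" "e \<noteq> e'" and "e \<inter> e' \<noteq> {}" for e e'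
  proof -
    \<comment> \<open>Properness is local: seen from a common endpoint \<open>v\<close>, both colors
      are values of the injective function \<open>f v\<close>.\<close>
    obtain v where "v \<in> e" "v \<in> e'"
      using \<open>e \<inter> e' \<noteq> {}\<close> by blast
    then have "\<exists>x. e = {v, x}" "\<exists>y. e' = {v, y}"
      using pairs[OF e(1)] pairs[OF e(2)] by auto
    then obtain x y where [simp]: "e = {v, x}" "e' = {v, y}"
      by blast
    show ?thesis
      using inj_onD[OF proper[of v], of x y] e c by (auto simp: neighbors_def)
  qed
  ultimately have prop_c: "proper_edge_coloring G k c"
    by (auto simp: proper_edge_coloring_def)
  have colors: "colors_at G c x = f x ` neighbors G x" for x
    by (subst colors_at_eq, erule pairs, rule image_cong) (simp_all add: neighbors_def c)
  have "inj_on (edge_color_code G k c) (verts G)"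
  proof (rule inj_onI)
    fix x y assume xy: "x \<in> verts G" "y \<in> verts G"
    assume "edge_color_code G k c x = edge_color_code G k c y"
    then have "colors_at G c x = colors_at G c y"
      by (rule edge_color_code_eq_imp_colors_at_eq[OF prop_c])
    then show "x = y"
      using inj_onD[OF distinct _ xy] by (simp add: colors)
  qed
  with prop_c show ?thesis
    by (auto simp: edge_locating_coloring_def)
qed

section \<open>Lower bounds from vertex degrees\<close>

lemma edge_locating_chromatic_number_eqI:
  assumes "\<exists>c. edge_locating_coloring G k c"
    and "\<And>k' c. edge_locating_coloring G k' c \<Longrightarrow> k \<le> k'"
  shows "edge_locating_chromatic_number G = enat k"
  unfolding edge_locating_chromatic_number_def
  by (intro antisym INF_lower INF_greatest) (use assms in auto)

text \<open>Different neighbors give different edges that share \<open>v\<close>. Working with a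
  subset \<open>S\<close> means that applications exhibit enough neighbors instead of computing the
  whole neighborhood.\<close>

lemma neighbor_colors:
  assumes "proper_edge_coloring G k c" "S \<subseteq> neighbors G v"
  shows "inj_on (\<lambda>w. c {v, w}) S" "(\<lambda>w. c {v, w}) ` S \<subseteq> colors_at G c v"
    "(\<lambda>w. c {v, w}) ` S \<subseteq> {1..k}"
proof -
  show "inj_on (\<lambda>w. c {v, w}) S"
  proof (rule inj_onI, rule ccontr)
    fix x y assume "x \<in> S" "y \<in> S" "c {v, x} = c {v, y}" "x \<noteq> y"
    moreover from this have "{v, x} \<noteq> {v, y}"
      by (auto simp: doubleton_eq_iff)
    ultimately show False
      using assms by (auto simp: proper_edge_coloring_def neighbors_def subset_eq)
  qed
  show "(\<lambda>w. c {v, w}) ` S \<subseteq> colors_at G c v"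
    using assms(2) by (auto simp: colors_at_def neighbors_def)
  with colors_at_subset[OF assms(1), of v] show "(\<lambda>w. c {v, w}) ` S \<subseteq> {1..k}"
    by blast
qed

lemma degree_le_colors:
  assumes "proper_edge_coloring G k c" "S \<subseteq> neighbors G v"
  shows "card S \<le> k"
  using card_inj_on_le[OF neighbor_colors(1,3)[OF assms]] by simp

text \<open>An injection of \<open>k\<close> neighbors into \<open>k\<close> colors is onto.\<close>

lemma full_degree_colors:
  assumes "proper_edge_coloring G k c" "S \<subseteq> neighbors G v" "card S = k"
  shows "{1..k} = (\<lambda>w. c {v, w}) ` S" "{1..k} \<subseteq> colors_at G c v"
proof -
  show *: "{1..k} = (\<lambda>w. c {v, w}) ` S"
    by (rule sym, rule card_subset_eq)
      (use neighbor_colors[OF assms(1,2)] assms(3) in \<open>auto simp: card_image\<close>)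
  show "{1..k} \<subseteq> colors_at G c v"
    unfolding * by (rule neighbor_colors(2)[OF assms(1,2)])
qed

lemma two_vertices_of_degree:
  assumes "edge_locating_coloring G k c"
    and "u \<in> verts G" "v \<in> verts G" "u \<noteq> v"
    and "S \<subseteq> neighbors G u" "T \<subseteq> neighbors G v" "card S = d" "card T = d"
  shows "Suc d \<le> k"
proof (rule ccontr)
  have prop_c: "proper_edge_coloring G k c" and inj: "inj_on (edge_color_code G k c) (verts G)"
    using assms(1) by (auto simp: edge_locating_coloring_def)
  assume "\<not> Suc d \<le> k"
  then have "d = k"
    using degree_le_colors[OF prop_c assms(5)] assms(7) by simp
  then have "edge_color_code G k c u = edge_color_code G k c v"
    using full_degree_colors(2)[OF prop_c assms(5)] full_degree_colors(2)[OF prop_c assms(6)] assms(7,8)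
    by (intro colors_at_full_imp_code_eq) auto
  then show False
    using inj assms(2-4) by (auto dest: inj_onD)
qed

section \<open>Neighborhoods in joins, copies, paths and cycles\<close>

lemma join_edges_iff [simp]:
  "{Inl a, Inl b} \<in> edges (join G H) \<longleftrightarrow> {a, b} \<in> edges G"
  "{Inr x, Inr y} \<in> edges (join G H) \<longleftrightarrow> {x, y} \<in> edges H"
  "{Inl a, Inr x} \<in> edges (join G H) \<longleftrightarrow> a \<in> verts G \<and> x \<in> verts H"
  "{Inr x, Inl a} \<in> edges (join G H) \<longleftrightarrow> a \<in> verts G \<and> x \<in> verts H"
proof -
  \<comment> \<open>Injectivity cancels the tags \<open>Inl\<close> and \<open>Inr\<close>; the
    facts \<open>ll\<close>, \<open>rr\<close> and \<open>lr\<close> rule out the mixed cases by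
    disjointness of their ranges.\<close>
  have inl: "{Inl a, Inl b} = Inl ` e \<longleftrightarrow> e = {a, b}" for e :: "'a set" and a b
    using inj_image_eq_iff[of Inl "{a, b}" e] by auto
  have inr: "{Inr a, Inr b} = Inr ` e \<longleftrightarrow> e = {a, b}" for e :: "'b set" and a b
    using inj_image_eq_iff[of Inr "{a, b}" e] by auto
  have ll: "{Inl a, Inl b} \<noteq> Inr ` e" and rr: "{Inr x, Inr y} \<noteq> Inl ` e'"
    and lr: "{Inl a, Inr x} \<noteq> Inr ` e" "{Inl a, Inr x} \<noteq> Inl ` e'"
    for a b :: 'a and x y :: 'b and e e' by auto
  show "{Inl a, Inl b} \<in> edges (join G H) \<longleftrightarrow> {a, b} \<in> edges G"
    using ll by (auto simp: join_def inl image_iff doubleton_eq_iff)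
  show "{Inr x, Inr y} \<in> edges (join G H) \<longleftrightarrow> {x, y} \<in> edges H"
    using rr by (auto simp: join_def inr image_iff doubleton_eq_iff)
  show "{Inl a, Inr x} \<in> edges (join G H) \<longleftrightarrow> a \<in> verts G \<and> x \<in> verts H"
    using lr by (auto simp: join_def image_iff doubleton_eq_iff)
  then show "{Inr x, Inl a} \<in> edges (join G H) \<longleftrightarrow> a \<in> verts G \<and> x \<in> verts H"
    by (simp add: insert_commute)
qed

lemma neighbors_join:
  "neighbors (join G H) (Inl a) = Inl ` neighbors G a \<union> (if a \<in> verts G then Inr ` verts H else {})"
  "neighbors (join G H) (Inr x) = Inr ` neighbors H x \<union> (if x \<in> verts H then Inl ` verts G else {})"
proof -
  have "w \<in> neighbors (join G H) (Inl a) \<longleftrightarrow>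
      w \<in> Inl ` neighbors G a \<union> (if a \<in> verts G then Inr ` verts H else {})"
    "w \<in> neighbors (join G H) (Inr x) \<longleftrightarrow>
      w \<in> Inr ` neighbors H x \<union> (if x \<in> verts H then Inl ` verts G else {})" for w
    by (cases w; auto simp: neighbors_def)+
  then show
    "neighbors (join G H) (Inl a) = Inl ` neighbors G a \<union> (if a \<in> verts G then Inr ` verts H else {})"
    "neighbors (join G H) (Inr x) = Inr ` neighbors H x \<union> (if x \<in> verts H then Inl ` verts G else {})"
    by blast+
qed

lemma neighbors_complete_graph:
  "neighbors (complete_graph n) i = (if i < n then {..<n} - {i} else {})"
  by (auto simp: neighbors_def complete_graph_def doubleton_eq_iff)

lemma neighbors_copies:
  "neighbors (copies n G) (i, a) = (if i < n then Pair i ` neighbors G a else {})"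
proof -
  \<comment> \<open>Every endpoint carries the number of its copy, so a nonempty edge determines
    that number, and injectivity of \<open>Pair i\<close> recovers the original edge.\<close>
  have eq: "{(i, a), (j, b)} = Pair i' ` e \<longleftrightarrow> i' = i \<and> j = i \<and> e = {a, b}" for i' j b e
  proof
    assume *: "{(i, a), (j, b)} = Pair i' ` e"
    then have "i' = i" "j = i" by (metis (no_types, lifting) imageE insertCI old.prod.inject)+
    moreover from this * have "Pair i ` {a, b} = Pair i ` e" by simp
    then have "{a, b} = e"
      by (subst (asm) inj_image_eq_iff) (simp_all add: inj_on_def)
    ultimately show "i' = i \<and> j = i \<and> e = {a, b}" by simp
  qed auto
  have "(j, b) \<in> neighbors (copies n G) (i, a) \<longleftrightarrow> i < n \<and> j = i \<and> b \<in> neighbors G a" for j b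
    unfolding neighbors_def copies_def by (simp only: eq graph.sel mem_Collect_eq) blast
  then show ?thesis
    by auto
qed

lemma verts_simps [simp]:
  "verts (complete_graph n) = {..<n}"
  "verts (path_graph n) = {..<n}"
  "verts (cycle_graph n) = {..<n}"
  "verts (copies n G) = {..<n} \<times> verts G"
  "verts (join G H) = verts G <+> verts H"
  by (simp_all add: complete_graph_def path_graph_def cycle_graph_def copies_def join_def)

lemma edge_pairs_basic:
  "e \<in> edges (complete_graph n) \<Longrightarrow> \<exists>x y. e = {x, y}"
  "e \<in> edges (path_graph n) \<Longrightarrow> \<exists>x y. e = {x, y}"
  "e \<in> edges (cycle_graph n) \<Longrightarrow> \<exists>x y. e = {x, y}"
  by (auto simp: complete_graph_def path_graph_def cycle_graph_def)

lemma edge_pairs_copies: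
  assumes "\<And>e. e \<in> edges G \<Longrightarrow> \<exists>x y. e = {x, y}" "e \<in> edges (copies n G)"
  shows "\<exists>x y. e = {x, y}"
  using assms by (fastforce simp: copies_def)

lemma edge_pairs_join:
  assumes "\<And>e. e \<in> edges G \<Longrightarrow> \<exists>x y. e = {x, y}" "\<And>e. e \<in> edges H \<Longrightarrow> \<exists>x y. e = {x, y}"
    and "e \<in> edges (join G H)"
  shows "\<exists>x y. e = {x, y}"
proof -
  consider e' where "e' \<in> edges G" "e = Inl ` e'" | e' where "e' \<in> edges H" "e = Inr ` e'"
    | x y where "e = {Inl x, Inr y}"
    using assms(3) by (auto simp: join_def)
  then show ?thesis
  proof cases
    case 1
    then show ?thesis using assms(1)[of e'] by auto
  next
    case 2
    then show ?thesis using assms(2)[of e'] by auto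
  qed auto
qed

lemma neighbors_path_graph:
  "neighbors (path_graph n) i = {j. i < n \<and> j < n \<and> (j = Suc i \<or> i = Suc j)}"
  by (auto simp: neighbors_def path_graph_def doubleton_eq_iff)

text \<open>The residue modulo \<open>n\<close> for arguments below \<open>2 * n\<close>, as a case
  split that keeps goals within linear arithmetic.\<close>

definition rot :: "nat \<Rightarrow> nat \<Rightarrow> nat" where
  "rot n i = (if i < n then i else i - n)"

lemma rot_eq_mod: "i < 2 * n \<Longrightarrow> rot n i = i mod n"
  by (auto simp: rot_def le_mod_geq)

text \<open>The predecessor is written with \<open>i + n - 1\<close> because \<open>i - 1\<close>
  would truncate at \<open>i = 0\<close>.\<close>

lemma neighbors_cycle_graph:
  assumes "n \<ge> 3"
  shows "neighbors (cycle_graph n) i = (if i < n then {rot n (i + 1), rot n (i + n - 1)} else {})"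
proof -
  have "{i, j} \<in> edges (cycle_graph n) \<longleftrightarrow>
      i < n \<and> j = rot n (i + 1) \<or> j < n \<and> i = rot n (j + 1)" for j
    using assms by (auto simp: cycle_graph_def doubleton_eq_iff rot_eq_mod)
  then show ?thesis
    using assms by (auto simp: neighbors_def rot_def split: if_splits)
qed

lemmas neighbors_simps =
  neighbors_join neighbors_complete_graph neighbors_copies neighbors_path_graph neighbors_cycle_graph

section \<open>Colorings of wheels and fans\<close>

text \<open>
  Counting colors from 0, spoke \<open>i\<close> gets color \<open>i\<close> and the rim edge from \<open>i\<close> to \<open>i + 1\<close> gets color
  \<open>i + 2\<close> modulo \<open>n\<close>, so that a rim vertex of the wheel meets \<open>{i, i + 1, i + 2}\<close>.
\<close>

fun rim_coloring :: "nat \<Rightarrow> nat + nat \<Rightarrow> nat + nat \<Rightarrow> nat" where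
  "rim_coloring n (Inl a) (Inl b) = 0"
| "rim_coloring n (Inl a) (Inr j) = Suc j"
| "rim_coloring n (Inr i) (Inl b) = Suc i"
| "rim_coloring n (Inr i) (Inr j) = Suc (rot n ((if j = rot n (i + 1) then i else j) + 2))"

lemma inj_on_Plus_iff:
  "inj_on F (A <+> B) \<longleftrightarrow> inj_on (\<lambda>a. F (Inl a)) A \<and> inj_on (\<lambda>b. F (Inr b)) B \<and>
     (\<forall>a\<in>A. \<forall>b\<in>B. F (Inl a) \<noteq> F (Inr b))"
  unfolding inj_on_def by (auto; metis)

text \<open>The rim \<open>H\<close> may have any of the edges of the cycle, which covers wheel and
  fan at once. The hub is separated by counting, so \<open>distinct\<close> compares rim vertices
  only.\<close>

lemma hub_coloring_exists:
  assumes n: "n \<ge> 4" and verts: "verts H = {..<n}"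
    and pairs: "\<And>e. e \<in> edges H \<Longrightarrow> \<exists>x y. e = {x, y}"
    and nbs: "\<And>i. neighbors H i \<subseteq> (if i < n then {rot n (i + 1), rot n (i + n - 1)} else {})"
    and distinct: "\<And>i j. i < n \<Longrightarrow> j < n \<Longrightarrow>
      insert (Suc i) (rim_coloring n (Inr i) ` Inr ` neighbors H i) =
      insert (Suc j) (rim_coloring n (Inr j) ` Inr ` neighbors H j) \<Longrightarrow> i = j"
  shows "\<exists>c. edge_locating_coloring (join (complete_graph 1) H) n c"
proof -
  define G where "G = join (complete_graph 1) H"
  have hub: "neighbors G (Inl a) = (if a = 0 then Inr ` {..<n} else {})" for a
    by (auto simp: G_def neighbors_join neighbors_complete_graph verts)
  have rim: "neighbors G (Inr i) = Inr ` neighbors H i \<union> (if i < n then {Inl 0} else {})" for i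
    by (auto simp: G_def neighbors_join verts)
  have cases: "i < n \<and> j < n \<and>
      (j = Suc i \<or> i = Suc j \<or> i = 0 \<and> j = n - 1 \<or> j = 0 \<and> i = n - 1)" if "j \<in> neighbors H i" for i j
    using nbs[of i] that n by (auto simp: rot_def split: if_splits)
  have pairs_G: "\<exists>x y. e = {x, y}" if "e \<in> edges G" for e
    using edge_pairs_join[OF edge_pairs_basic(1) pairs that[unfolded G_def]] .
  have sym_G: "rim_coloring n x y = rim_coloring n y x" if "y \<in> neighbors G x" for x y
    using that n by (cases x; cases y) (auto simp: hub rim rot_def split: if_splits dest!: cases)
  have range_G: "rim_coloring n x y \<in> {1..n}" if "y \<in> neighbors G x" for x y
    using that n by (cases x; cases y) (auto simp: hub rim rot_def split: if_splits dest!: cases)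
  \<comment> \<open>The spokes alone use all colors; the shift by one sends color \<open>m\<close>
    to rim vertex \<open>m - 1\<close>.\<close>
  have onto_G: "\<exists>x. \<exists>y\<in>neighbors G x. rim_coloring n x y = m" if "m \<in> {1..n}" for m
    using that by (intro exI[of _ "Inl 0"] bexI[of _ "Inr (m - 1)"]) (auto simp: hub)
  \<comment> \<open>Counting from 0, the edge to the successor starts at \<open>i\<close> and has
    color \<open>i + 2\<close>; the edge to the predecessor starts at \<open>i - 1\<close> and has
    color \<open>i + 1\<close>.\<close>
  have rim_color: "j = rot n (i + 1) \<and> rim_coloring n (Inr i) (Inr j) = Suc (rot n (i + 2)) \<or>
      j = rot n (i + n - 1) \<and> rim_coloring n (Inr i) (Inr j) = Suc (rot n (i + 1))"
    if "j \<in> neighbors H i" for i j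
    using cases[OF that] n by (auto simp: rot_def)
  have rot_distinct: "rot n (i + 1) \<noteq> i" "rot n (i + 2) \<noteq> i" "rot n (i + 2) \<noteq> rot n (i + 1)"
    if "i < n" for i
    using that n by (auto simp: rot_def)
  have proper_G: "inj_on (rim_coloring n x) (neighbors G x)" for x
  proof (cases x)
    case (Inl a)
    then show ?thesis
      by (auto simp: hub inj_on_def)
  next
    case (Inr i)
    have inj: "x = y" if xy: "x \<in> neighbors H i" "y \<in> neighbors H i"
      and eq: "rim_coloring n (Inr i) (Inr x) = rim_coloring n (Inr i) (Inr y)" for x y
      using rim_color[OF xy(1)] rim_color[OF xy(2)] rot_distinct(3)[of i] cases[OF xy(1), THEN conjunct1] eq
      by (elim disjE) (simp_all del: rim_coloring.simps, auto simp del: rim_coloring.simps)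
    have ne: "rim_coloring n (Inr i) (Inr x) \<noteq> Suc i" if "x \<in> neighbors H i" for x
      using rim_color[OF that] rot_distinct(1,2)[of i] cases[OF that, THEN conjunct1]
      by (elim disjE) (simp_all del: rim_coloring.simps, auto simp del: rim_coloring.simps)
    show ?thesis
      unfolding Inr rim inj_on_def
      by (auto simp: ne ne[THEN not_sym] inj simp del: rim_coloring.simps(4) split: if_splits)
  qed
  have hub_colors: "rim_coloring n (Inl 0) ` neighbors G (Inl 0) = {1..n}"
    by (simp add: hub image_image image_Suc_lessThan)
  have rim_colors: "rim_coloring n (Inr i) ` neighbors G (Inr i) =
      insert (Suc i) (rim_coloring n (Inr i) ` Inr ` neighbors H i)" if "i < n" for i
    using that by (simp add: rim image_Un)
  \<comment> \<open>A rim vertex has at most three neighbors and so meets at most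
    \<open>3 < n\<close> colors, whereas the hub meets all \<open>n\<close>.\<close>
  have "card (rim_coloring n (Inr i) ` neighbors G (Inr i)) < n" if "i < n" for i
  proof -
    have "neighbors G (Inr i) \<subseteq> set [Inl 0, Inr (rot n (i + 1)), Inr (rot n (i + n - 1))]"
      using nbs[of i] that by (auto simp: rim)
    then have "rim_coloring n (Inr i) ` neighbors G (Inr i) \<subseteq>
        set (map (rim_coloring n (Inr i)) [Inl 0, Inr (rot n (i + 1)), Inr (rot n (i + n - 1))])"
      (is "?A \<subseteq> set ?xs")
      by (simp only: set_map image_mono)
    then have "card ?A \<le> card (set ?xs)"
      by (intro card_mono) simp_all
    also have "\<dots> \<le> length ?xs"
      by (rule card_length)
    finally show ?thesis
      using n by simp
  qed
  then have "{1..n} \<noteq> insert (Suc i) (rim_coloring n (Inr i) ` Inr ` neighbors H i)" if "i < n" for i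
    using that by (metis card_atLeastAtMost diff_Suc_1 less_irrefl rim_colors)
  then have distinct_G: "inj_on (\<lambda>x. rim_coloring n x ` neighbors G x) (verts G)"
    unfolding G_def[THEN arg_cong, of verts] verts_simps inj_on_Plus_iff verts
    using distinct by (auto simp: hub_colors lessThan_Suc inj_on_def rim_colors)
  show ?thesis
    unfolding G_def[symmetric]
    using pairs_G sym_G range_G onto_G proper_G distinct_G by (rule edge_locating_coloring_exists)
qed

lemma wheel_coloring:
  assumes "n \<ge> 4"
  shows "\<exists>c. edge_locating_coloring (wheel n) n c"
  unfolding wheel_def
proof (rule hub_coloring_exists)
  have n: "3 \<le> n" using assms by simp
  have colors: "insert (Suc i) (rim_coloring n (Inr i) ` Inr ` neighbors (cycle_graph n) i) =
      {Suc i, Suc (rot n (i + 1)), Suc (rot n (i + 2))}" if "i < n" for i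
    using assms that unfolding neighbors_cycle_graph[OF n] by (auto simp: rot_def)
  show "i = j" if ij: "i < n" "j < n" and
    eq: "insert (Suc i) (rim_coloring n (Inr i) ` Inr ` neighbors (cycle_graph n) i) =
      insert (Suc j) (rim_coloring n (Inr j) ` Inr ` neighbors (cycle_graph n) j)" for i j
  proof -
    \<comment> \<open>Cyclic intervals of length 3 determine their start: the first two memberships
      leave only \<open>i = j\<close> or, for \<open>n = 4\<close>, opposite vertices, and the last
      two exclude the latter.\<close>
    have "Suc i \<in> {Suc j, Suc (rot n (j + 1)), Suc (rot n (j + 2))}"
      "Suc j \<in> {Suc i, Suc (rot n (i + 1)), Suc (rot n (i + 2))}"
      "Suc (rot n (i + 1)) \<in> {Suc j, Suc (rot n (j + 1)), Suc (rot n (j + 2))}"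
      "Suc (rot n (j + 1)) \<in> {Suc i, Suc (rot n (i + 1)), Suc (rot n (i + 2))}"
      using eq unfolding colors[OF ij(1)] colors[OF ij(2)] by blast+
    then show ?thesis
      using assms ij by (auto simp: rot_def split: if_splits)
  qed
qed (use assms neighbors_cycle_graph[of n] in \<open>auto simp: edge_pairs_basic\<close>)

lemma fan_coloring:
  assumes "n \<ge> 4"
  shows "\<exists>c. edge_locating_coloring (fan n) n c"
  unfolding fan_def
proof (rule hub_coloring_exists)
  \<comment> \<open>The edge to the predecessor is missing at \<open>i = 0\<close> and the edge to
    the successor at \<open>i = n - 1\<close>. Counting from 0, the ends of the path meet
    \<open>{0, 2}\<close> and \<open>{n - 1, 0}\<close>, which differ for \<open>n \<ge> 4\<close>;
    inner vertices meet three colors.\<close>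
  have colors: "insert (Suc i) (rim_coloring n (Inr i) ` Inr ` neighbors (path_graph n) i) =
      {Suc i} \<union> (if 0 < i then {Suc (rot n (i + 1))} else {}) \<union>
      (if i + 1 < n then {Suc (rot n (i + 2))} else {})" (is "_ = ?A i") if "i < n" for i
  proof -
    have "neighbors (path_graph n) i =
        (if 0 < i then {i - 1} else {}) \<union> (if i + 1 < n then {i + 1} else {})"
      using that by (auto simp: neighbors_path_graph)
    then show ?thesis
      using assms that by (auto simp: rot_def)
  qed
  show "i = j" if ij: "i < n" "j < n" and
    eq: "insert (Suc i) (rim_coloring n (Inr i) ` Inr ` neighbors (path_graph n) i) =
      insert (Suc j) (rim_coloring n (Inr j) ` Inr ` neighbors (path_graph n) j)" for i j
  proof -
    have eq': "?A i = ?A j"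
      using eq colors ij by simp
    have "Suc i \<in> ?A j" unfolding eq'[symmetric] by simp
    moreover have "Suc j \<in> ?A i" unfolding eq' by simp
    moreover have "0 < i \<Longrightarrow> Suc (rot n (i + 1)) \<in> ?A j" unfolding eq'[symmetric] by simp
    moreover have "0 < j \<Longrightarrow> Suc (rot n (j + 1)) \<in> ?A i" unfolding eq' by simp
    ultimately show ?thesis
      using assms ij by (auto simp: rot_def split: if_splits)
  qed
qed (use assms in \<open>auto simp: edge_pairs_basic neighbors_path_graph rot_def\<close>)
lemma small_fan_coloring:
  assumes "n = 2 \<or> n = 3"
  shows "\<exists>c. edge_locating_coloring (fan n) (Suc n) c"
proof -
  \<comment> \<open>The condition \<open>i + j = 1\<close> singles out the path edge between 0 and
    1, which gets the extra color. For \<open>n = 3\<close> the other path edge reuses color 1 of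
    the spoke at 0, which it does not touch.\<close>
  define f :: "nat + nat \<Rightarrow> nat + nat \<Rightarrow> nat" where
    "f x y = (case x of Inl a \<Rightarrow> (case y of Inl b \<Rightarrow> 0 | Inr j \<Rightarrow> Suc j)
      | Inr i \<Rightarrow> (case y of Inl b \<Rightarrow> Suc i | Inr j \<Rightarrow> if i + j = 1 then Suc n else 1))" for x y
  have hub: "neighbors (fan n) (Inl a) = (if a = 0 then Inr ` {..<n} else {})" for a
    by (auto simp: fan_def neighbors_simps)
  have rim: "neighbors (fan n) (Inr i) = (if i < n then
      insert (Inl 0) (Inr ` {j. j < n \<and> (j = Suc i \<or> i = Suc j)}) else {})" for i
    by (auto simp: fan_def neighbors_simps)
  have rim_explicit: "neighbors (fan n) (Inr 0) = {Inl 0, Inr 1}"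
    "neighbors (fan n) (Inr 1) = (if n = 2 then {Inl 0, Inr 0} else {Inl 0, Inr 0, Inr 2})"
    "n = 3 \<Longrightarrow> neighbors (fan n) (Inr 2) = {Inl 0, Inr 1}"
    using assms unfolding rim by auto
  show ?thesis
  proof (rule edge_locating_coloring_exists[where f = f])
    show "\<exists>x y. e = {x, y}" if "e \<in> edges (fan n)" for e
      using edge_pairs_join[OF edge_pairs_basic(1,2) that[unfolded fan_def]] .
    show "f x y = f y x" if "y \<in> neighbors (fan n) x" for x y
      by (auto simp: f_def split: sum.splits)
    show "f x y \<in> {1..Suc n}" if "y \<in> neighbors (fan n) x" for x y
      using that by (cases x; cases y) (auto simp: f_def hub rim split: if_splits)
    show "\<exists>x. \<exists>y\<in>neighbors (fan n) x. f x y = m" if "m \<in> {1..Suc n}" for m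
    proof (cases "m = Suc n")
      case True
      then show ?thesis
        using assms by (intro exI[of _ "Inr 0"] bexI[of _ "Inr 1"]) (auto simp: f_def rim)
    next
      case False
      with that show ?thesis
        by (intro exI[of _ "Inl 0"] bexI[of _ "Inr (m - 1)"]) (auto simp: f_def hub)
    qed
    show "inj_on (f x) (neighbors (fan n) x)" for x
    proof (cases x)
      case (Inl a)
      then show ?thesis
        by (auto simp: f_def hub inj_on_def)
    next
      case (Inr i)
      consider "i = 0" | "i = 1" | "i = 2" "n = 3" | "\<not> i < n"
        using assms by linarith
      then show ?thesis
      proof cases
        case 1
        then show ?thesis using assms by (auto simp: Inr f_def rim_explicit)
      next
        case 2
        then show ?thesis using assms by (auto simp: Inr f_def rim_explicit(2)[simplified])
      next
        case 3
        then show ?thesis unfolding Inr 3(1) rim_explicit(3)[OF 3(2)] by (simp add: f_def)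
      next
        case 4
        then show ?thesis by (simp add: Inr rim)
      qed
    qed
    define F where "F x = f x ` neighbors (fan n) x" for x
    have hub_colors: "F (Inl 0) = {1..n}"
      by (simp add: F_def f_def hub image_image image_Suc_lessThan)
    have rim_colors: "F (Inr 0) = {1, Suc n}" "F (Inr 1) = (if n = 2 then {2, 3} else {1, 2, 4})"
      using assms unfolding F_def rim_explicit by (auto simp: f_def)
    have rim_colors_2: "F (Inr 2) = {1, 3}" if "n = 3"
      unfolding F_def rim_explicit(3)[OF that] by (auto simp: f_def)
    have "inj_on F (verts (fan n))"
      using assms
    proof
      assume "n = 2"
      then have "F (Inl 0) = {1, 2}" "F (Inr 0) = {1, 3}" "F (Inr 1) = {2, 3}"
        using hub_colors rim_colors by auto
      note F = this
      have verts: "verts (fan n) = {Inl 0, Inr 0, Inr 1}"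
        using \<open>n = 2\<close> by (auto simp: fan_def)
      show ?thesis
        unfolding verts inj_on_def by (simp add: F[simplified]) (simp add: set_eq_subset)
    next
      assume "n = 3"
      then have "F (Inl 0) = {1, 2, 3}" "F (Inr 0) = {1, 4}" "F (Inr 1) = {1, 2, 4}" "F (Inr 2) = {1, 3}"
        using hub_colors rim_colors rim_colors_2 by auto
      note F = this
      have verts: "verts (fan n) = {Inl 0, Inr 0, Inr 1, Inr 2}"
        using \<open>n = 3\<close> by (auto simp: fan_def)
      show ?thesis
        unfolding verts inj_on_def by (simp add: F[simplified]) (simp add: set_eq_subset)
    qed
    then show "inj_on (\<lambda>x. f x ` neighbors (fan n) x) (verts (fan n))"
      by (simp add: F_def[abs_def])
  qed
qed

section \<open>Colorings of windmills and books\<close>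

text \<open>Makes \<open>2 * i + s\<close> an injective numbering of the ends \<open>(i, s)\<close>
  of the copies of \<open>K_2\<close>.\<close>

lemma double_add_bit_eq_iff:
  fixes i j s t :: nat
  assumes "s < 2" "t < 2"
  shows "2 * i + s = 2 * j + t \<longleftrightarrow> i = j \<and> s = t"
proof
  assume eq: "2 * i + s = 2 * j + t"
  have "i = (2 * i + s) div 2" "j = (2 * j + t) div 2"
    using assms by simp_all
  then have "i = j"
    unfolding eq by simp
  with eq show "i = j \<and> s = t" by simp
qed auto

lemma edge_pairs_blades: "e \<in> edges (copies n (complete_graph 2)) \<Longrightarrow> \<exists>x y. e = {x, y}"
  by (rule edge_pairs_copies[OF edge_pairs_basic(1)])

text \<open>The function \<open>p\<close> colors the blades; the spokes get the colors \<open>1, \<dots>, 2n\<close>.\<close>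

lemma windmill_coloring_exists:
  fixes p :: "nat \<Rightarrow> nat"
  assumes n: "n \<ge> 2" and k: "2 * n \<le> k"
    and p_range: "\<And>i. i < n \<Longrightarrow> p i \<in> {1..k}"
    and p_onto: "\<And>m. 2 * n < m \<Longrightarrow> m \<le> k \<Longrightarrow> \<exists>i<n. p i = m"
    and p_proper: "\<And>i. i < n \<Longrightarrow> p i \<notin> {2 * i + 1, 2 * i + 2}"
    and p_distinct: "\<And>i j. i < n \<Longrightarrow> j < n \<Longrightarrow> i \<noteq> j \<Longrightarrow>
      p i \<in> {2 * j + 1, 2 * j + 2} \<Longrightarrow> p j \<notin> {2 * i + 1, 2 * i + 2}"
  shows "\<exists>c. edge_locating_coloring (windmill n) k c"
proof -
  define f :: "nat + nat \<times> nat \<Rightarrow> nat + nat \<times> nat \<Rightarrow> nat" where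
    "f x y = (case x of Inl a \<Rightarrow> (case y of Inl b \<Rightarrow> 0 | Inr (j, t) \<Rightarrow> 2 * j + t + 1)
      | Inr (i, s) \<Rightarrow> (case y of Inl b \<Rightarrow> 2 * i + s + 1 | Inr (j, t) \<Rightarrow> p i))" for x y
  have hub: "neighbors (windmill n) (Inl a) = (if a = 0 then Inr ` ({..<n} \<times> {..<2}) else {})" for a
    by (auto simp: windmill_def neighbors_simps)
  have rim: "neighbors (windmill n) (Inr (i, s)) = (if i < n \<and> s < 2 then {Inl 0, Inr (i, 1 - s)} else {})"
    for i s
    by (auto simp: windmill_def neighbors_simps less_2_cases_iff)
  show ?thesis
  proof (rule edge_locating_coloring_exists[where f = f])
    show "\<exists>x y. e = {x, y}" if "e \<in> edges (windmill n)" for e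
      using edge_pairs_join[OF edge_pairs_basic(1) edge_pairs_blades that[unfolded windmill_def]] .
    show "f x y = f y x" if "y \<in> neighbors (windmill n) x" for x y
      using that by (cases x; cases y) (auto simp: f_def hub rim split: if_splits)
    show "f x y \<in> {1..k}" if "y \<in> neighbors (windmill n) x" for x y
      using that k p_range by (cases x; cases y) (auto simp: f_def hub rim split: if_splits)
    show "\<exists>x. \<exists>y\<in>neighbors (windmill n) x. f x y = m" if "m \<in> {1..k}" for m
    proof (cases "m \<le> 2 * n")
      case True
      \<comment> \<open>Color \<open>m\<close> sits on the spoke numbered \<open>m - 1\<close>,
        decoded into blade and end; the larger colors can come only from blades.\<close>
      with that show ?thesis
        by (intro exI[of _ "Inl 0"] bexI[of _ "Inr ((m - 1) div 2, (m - 1) mod 2)"])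
          (auto simp: f_def hub)
    next
      case False
      with p_onto[of m] that obtain i where "i < n" "p i = m"
        by auto
      then show ?thesis
        by (intro exI[of _ "Inr (i, 0)"] bexI[of _ "Inr (i, 1)"]) (auto simp: f_def rim)
    qed
    show "inj_on (f x) (neighbors (windmill n) x)" for x
    proof (cases x)
      case (Inl a)
      then show ?thesis
        by (auto simp: f_def hub inj_on_def; presburger)
    next
      case (Inr q)
      then show ?thesis
        using p_proper[of "fst q"] by (cases q) (auto simp: f_def rim inj_on_def less_2_cases_iff)
    qed
    have rim_colors: "f (Inr (i, s)) ` neighbors (windmill n) (Inr (i, s)) = {2 * i + s + 1, p i}"
      if "i < n" "s < 2" for i s
      using that by (auto simp: f_def rim)
    \<comment> \<open>With two blades the hub already meets three colors, more than any blade
      end.\<close>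
    have "{f (Inl 0) (Inr (0, 0)), f (Inl 0) (Inr (0, 1)), f (Inl 0) (Inr (1, 0))} \<subseteq>
        f (Inl 0) ` neighbors (windmill n) (Inl 0)"
      using n unfolding hub by (intro insert_subsetI imageI) auto
    then have "{1, 2, 3} \<subseteq> f (Inl 0) ` neighbors (windmill n) (Inl 0)"
      by (simp add: f_def numeral_3_eq_3 numeral_2_eq_2)
    moreover have "\<not> {1, 2, 3} \<subseteq> {a, b}" for a b :: nat
      by auto
    ultimately have "f (Inl 0) ` neighbors (windmill n) (Inl 0) \<noteq> {a, b}" for a b
      by metis
    \<comment> \<open>Spoke colors are distinct, so equal pairs for \<open>i \<noteq> j\<close> must
      match crosswise: each blade has the color of a spoke of the other, against
      \<open>p_distinct\<close>.\<close>
    moreover have "i = j \<and> s = t"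
      if "i < n" "j < n" "s < 2" "t < 2" "{2 * i + s + 1, p i} = {2 * j + t + 1, p j}" for i j s t
    proof (cases "i = j")
      case True
      then show ?thesis using that(5) by (auto simp: doubleton_eq_iff)
    next
      case False
      then show ?thesis
        using that(5) p_distinct[OF that(1,2)] that(3,4)
        by (auto simp: doubleton_eq_iff less_2_cases_iff; presburger)
    qed
    ultimately show "inj_on (\<lambda>x. f x ` neighbors (windmill n) x) (verts (windmill n))"
      unfolding windmill_def[THEN arg_cong, of verts] verts_simps inj_on_Plus_iff
      by (auto simp: inj_on_def rim_colors)
  qed
qed

lemma book_coloring:
  assumes n: "n \<ge> 2"
  shows "\<exists>c. edge_locating_coloring (book n) (2 * n + 2) c"
proof -
  \<comment> \<open>The two spine vertices use shifted colorings, and all pages and the spine share one color.\<close>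
  define h where "h a m = (if a = 0 then m + 1 else if m = 2 * n - 1 then 2 * n + 2 else m + 2)" for a m :: nat
  define f :: "nat + nat \<times> nat \<Rightarrow> nat + nat \<times> nat \<Rightarrow> nat" where
    "f x y = (case x of Inl a \<Rightarrow> (case y of Inl b \<Rightarrow> 2 * n + 1 | Inr (j, t) \<Rightarrow> h a (2 * j + t))
      | Inr (i, s) \<Rightarrow> (case y of Inl b \<Rightarrow> h b (2 * i + s) | Inr (j, t) \<Rightarrow> 2 * n + 1))" for x y
  have spine: "neighbors (book n) (Inl a) =
      (if a < 2 then insert (Inl (1 - a)) (Inr ` ({..<n} \<times> {..<2})) else {})" for a
    by (auto simp: book_def neighbors_simps less_2_cases_iff)
  have page: "neighbors (book n) (Inr (i, s)) =
      (if i < n \<and> s < 2 then {Inl 0, Inl 1, Inr (i, 1 - s)} else {})" for i s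
    by (auto simp: book_def neighbors_simps less_2_cases_iff)
  have h_inj: "h a m = h a m' \<longleftrightarrow> m = m'" if "m < 2 * n" "m' < 2 * n" for a m m'
    using that by (auto simp: h_def)
  \<comment> \<open>The exceptional value of \<open>h\<close> at \<open>2 * n - 1\<close> skips
    \<open>2 * n + 1\<close>, which is reserved for the spine and the pages.\<close>
  have h_range: "h a m \<noteq> 2 * n + 1" "1 \<le> h a m" "h a m \<le> 2 * n + 2" if "m < 2 * n" for a m
    using that by (auto simp: h_def)
  have h_eq: "h a (2 * i + s) = h a (2 * j + t) \<longleftrightarrow> i = j \<and> s = t"
    "h a (2 * i + s) \<noteq> 2 * n + 1" "1 \<le> h a (2 * i + s)" "h a (2 * i + s) \<le> 2 * n + 2"
    if "i < n" "j < n" "s < 2" "t < 2" for a i j s t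
  proof -
    have less: "2 * i + s < 2 * n" "2 * j + t < 2 * n"
      using that by auto
    show "h a (2 * i + s) = h a (2 * j + t) \<longleftrightarrow> i = j \<and> s = t"
      using h_inj[OF less] double_add_bit_eq_iff[OF that(3,4)] by simp
    show "h a (2 * i + s) \<noteq> 2 * n + 1" "1 \<le> h a (2 * i + s)" "h a (2 * i + s) \<le> 2 * n + 2"
      using h_range[OF less(1)] by simp_all
  qed
  show ?thesis
  proof (rule edge_locating_coloring_exists[where f = f])
    show "\<exists>x y. e = {x, y}" if "e \<in> edges (book n)" for e
      using edge_pairs_join[OF edge_pairs_basic(1) edge_pairs_blades that[unfolded book_def]] .
    show "f x y = f y x" if "y \<in> neighbors (book n) x" for x y
      using that by (cases x; cases y) (auto simp: f_def spine page split: if_splits)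
    show "f x y \<in> {1..2 * n + 2}" if "y \<in> neighbors (book n) x" for x y
      using that h_eq(3,4) by (cases x; cases y) (auto simp: f_def spine page split: if_splits)
    show "\<exists>x. \<exists>y\<in>neighbors (book n) x. f x y = m" if "m \<in> {1..2 * n + 2}" for m
    proof -
      consider "m \<le> 2 * n" | "m = 2 * n + 1" | "m = 2 * n + 2"
        using \<open>m \<in> {1..2 * n + 2}\<close> by fastforce
      then show ?thesis
      proof cases
        case 1
        with that show ?thesis
          by (intro exI[of _ "Inl 0"] bexI[of _ "Inr ((m - 1) div 2, (m - 1) mod 2)"])
            (auto simp: f_def h_def spine)
      next
        case 2
        then show ?thesis
          by (intro exI[of _ "Inl 0"] bexI[of _ "Inl 1"]) (auto simp: f_def spine)
      next
        \<comment> \<open>Only \<open>h 1\<close> takes this value, at the last number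
          \<open>2 * n - 1 = 2 * (n - 1) + 1\<close>.\<close>
        case 3
        then show ?thesis
          using n by (intro exI[of _ "Inl 1"] bexI[of _ "Inr (n - 1, 1)"]) (auto simp: f_def h_def spine)
      qed
    qed
    show "inj_on (f x) (neighbors (book n) x)" for x
    proof (cases x)
      case (Inl a)
      then show ?thesis
        using h_eq(1,2) h_eq(2)[THEN not_sym]
        by (auto simp: f_def spine inj_on_def)
    next
      case (Inr q)
      obtain i s where q: "q = (i, s)" by fastforce
      have "h 0 m \<noteq> h 1 m" for m
        by (auto simp: h_def)
      then show ?thesis
        using h_eq(2)[of i i s s] h_eq(2)[of i i s s, THEN not_sym]
        by (simp add: Inr q f_def page inj_on_def) (metis One_nat_def)
    qed
    have page_colors: "f (Inr (i, s)) ` neighbors (book n) (Inr (i, s)) =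
        {h 0 (2 * i + s), h 1 (2 * i + s), 2 * n + 1}" if "i < n" "s < 2" for i s
      using that by (auto simp: f_def page)
    have spine_colors: "f (Inl a) ` neighbors (book n) (Inl a) =
        insert (2 * n + 1) (h a ` {..<2 * n})" if "a < 2" for a
    proof -
      have "{..<2 * n} = (\<lambda>(i, s). 2 * i + s) ` ({..<n} \<times> {..<2})"
      proof (intro subset_antisym subsetI)
        fix m assume "m \<in> {..<2 * n}"
        then show "m \<in> (\<lambda>(i, s). 2 * i + s) ` ({..<n} \<times> {..<2})"
          by (intro image_eqI[of _ _ "(m div 2, m mod 2)"]) auto
      qed auto
      then show ?thesis
        using that by (simp add: f_def spine image_image case_prod_beta)
    qed
    define F where "F x = f x ` neighbors (book n) x" for x
    have page_eq: "F (Inr (i, s)) = {h 0 (2 * i + s), h 1 (2 * i + s), 2 * n + 1}"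
      if "i < n" "s < 2" for i s
      using page_colors[OF that] by (simp add: F_def)
    \<comment> \<open>Page vertices meet at most three colors. A spine vertex meets at least five:
      those of the spokes numbered 0, 1, 2 and \<open>2 * n - 1 \<ge> 3\<close>, and
      \<open>2 * n + 1\<close>.\<close>
    have "F (Inl a) \<noteq> {x, y, z}" if "a < 2" for a x y z
    proof
      assume "F (Inl a) = {x, y, z}"
      moreover have "h a ` {0, 1, 2} \<subseteq> F (Inl a)" "2 * n + 1 \<in> F (Inl a)"
        "h a (2 * n - 1) \<in> F (Inl a)"
        using n unfolding F_def spine_colors[OF that] by auto
      ultimately have "h a ` {0, 1, 2} \<union> {2 * n + 1, h a (2 * n - 1)} \<subseteq> {x, y, z}"
        by blast
      then have "card (h a ` {0, 1, 2} \<union> {2 * n + 1, h a (2 * n - 1)}) \<le> card {x, y, z}"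
        by (intro card_mono) auto
      also have "\<dots> \<le> 3"
        by (simp add: card_insert_if)
      finally show False
        using n by (auto simp: h_def card_insert_if split: if_splits)
    qed
    moreover have "F (Inl 0) \<noteq> F (Inl 1)"
    proof -
      have "2 * n + 2 \<in> F (Inl 1)"
        using n by (auto simp: F_def spine_colors h_def intro!: image_eqI[of _ _ "2 * n - 1"])
      moreover have "2 * n + 2 \<notin> F (Inl 0)"
        by (auto simp: F_def spine_colors h_def)
      ultimately show ?thesis by blast
    qed
    \<comment> \<open>If \<open>m \<noteq> m'\<close>, then \<open>h 0 m\<close> would have to be
      \<open>h 1 m'\<close> and conversely, giving both \<open>m = m' + 1\<close> and
      \<open>m' = m + 1\<close>.\<close>
    moreover have page_inj: "m = m'" if "m < 2 * n" "m' < 2 * n"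
      and eq: "{h 0 m, h 1 m, 2 * n + 1} = {h 0 m', h 1 m', 2 * n + 1}" for m m'
    proof -
      have "h 0 m \<in> {h 0 m', h 1 m', 2 * n + 1}" "h 0 m' \<in> {h 0 m, h 1 m, 2 * n + 1}"
        using eq by blast+
      then show ?thesis
        using that(1,2) by (auto simp: h_def split: if_splits)
    qed
    moreover have "inj_on (\<lambda>q. F (Inr q)) ({..<n} \<times> {..<2})"
    proof (rule inj_onI)
      fix q r
      assume "q \<in> {..<n} \<times> {..<2}" "r \<in> {..<n} \<times> {..<2}" "F (Inr q) = F (Inr r)"
      moreover obtain i s j t where q: "q = (i, s)" "r = (j, t)"
        by fastforce
      ultimately have "2 * i + s = 2 * j + t" "s < 2" "t < 2"
        using page_inj[of "2 * i + s" "2 * j + t"] by (auto simp: page_eq)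
      then have "i = j \<and> s = t"
        by (simp add: double_add_bit_eq_iff)
      then show "q = r"
        by (simp add: q)
    qed
    ultimately have "inj_on F (verts (book n))"
      unfolding book_def[THEN arg_cong, of verts] verts_simps inj_on_Plus_iff
      by (auto simp: inj_on_def[of _ "{..<2}"] page_eq less_2_cases_iff)
    then show "inj_on (\<lambda>x. f x ` neighbors (book n) x) (verts (book n))"
      by (simp add: F_def[abs_def])
  qed
qed

section \<open>Values of the edge-locating chromatic number\<close>

lemma wheel_number:
  assumes "n \<ge> 4"
  shows "edge_locating_chromatic_number (wheel n) = enat n"
proof (rule edge_locating_chromatic_number_eqI[OF wheel_coloring[OF assms]])
  fix k c assume "edge_locating_coloring (wheel n) k c"
  then have "proper_edge_coloring (wheel n) k c"
    by (simp add: edge_locating_coloring_def)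
  then have "card (Inr ` {..<n} :: (nat + nat) set) \<le> k"
    by (rule degree_le_colors[where v = "Inl 0"]) (auto simp: wheel_def neighbors_join)
  then show "n \<le> k"
    by (simp add: card_image)
qed

lemma fan_number:
  assumes "n \<ge> 4"
  shows "edge_locating_chromatic_number (fan n) = enat n"
proof (rule edge_locating_chromatic_number_eqI[OF fan_coloring[OF assms]])
  fix k c assume "edge_locating_coloring (fan n) k c"
  then have "proper_edge_coloring (fan n) k c"
    by (simp add: edge_locating_coloring_def)
  then have "card (Inr ` {..<n} :: (nat + nat) set) \<le> k"
    by (rule degree_le_colors[where v = "Inl 0"]) (auto simp: fan_def neighbors_join)
  then show "n \<le> k"
    by (simp add: card_image)
qed

text \<open>For these two sizes rim vertex 1 is adjacent to all other vertices, so it has the same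
  degree \<open>n\<close> as the hub.\<close>

lemma small_fan_number:
  assumes "n = 2 \<or> n = 3"
  shows "edge_locating_chromatic_number (fan n) = enat (Suc n)"
proof (rule edge_locating_chromatic_number_eqI[OF small_fan_coloring[OF assms]])
  fix k c assume loc: "edge_locating_coloring (fan n) k c"
  show "Suc n \<le> k"
  proof (rule two_vertices_of_degree[OF loc])
    show "Inr ` {..<n} \<subseteq> neighbors (fan n) (Inl 0)"
      by (auto simp: fan_def neighbors_join)
    show "insert (Inl 0) (Inr ` ({..<n} - {1})) \<subseteq> neighbors (fan n) (Inr 1)"
      using assms by (auto simp: fan_def neighbors_simps)
    show "card (insert (Inl 0) (Inr ` ({..<n} - {1}))) = n"
      using assms by (auto simp: card_insert_if card_image)
  qed (use assms in \<open>auto simp: fan_def card_image\<close>)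
qed

lemma windmill_hub_neighbors:
  "Inr ` ({..<n} \<times> {..<2}) \<subseteq> neighbors (windmill n) (Inl 0)"
  "card (Inr ` ({..<n} \<times> {..<2::nat}) :: (nat + nat \<times> nat) set) = 2 * n"
  by (auto simp: windmill_def neighbors_join card_image card_cartesian_product)

lemma windmill_number:
  assumes "n \<ge> 3"
  shows "edge_locating_chromatic_number (windmill n) = enat (2 * n)"
proof (rule edge_locating_chromatic_number_eqI)
  show "\<exists>c. edge_locating_coloring (windmill n) (2 * n) c"
  proof (rule windmill_coloring_exists)
    \<comment> \<open>Each blade borrows the color \<open>2 * (i + 1) + 1\<close> of the first spoke
      of the next blade in cyclic order. With at least three blades no two borrow from each
      other.\<close>
    define p where "p i = (if i + 1 < n then 2 * i + 3 else 1)" for i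
    show "p i \<in> {1..2 * n}" if "i < n" for i
      using assms that by (auto simp: p_def)
    show "p i \<notin> {2 * i + 1, 2 * i + 2}" if "i < n" for i
      using assms that by (auto simp: p_def)
    show "p j \<notin> {2 * i + 1, 2 * i + 2}"
      if "i < n" "j < n" "i \<noteq> j" "p i \<in> {2 * j + 1, 2 * j + 2}" for i j
    proof -
      \<comment> \<open>A borrowed color reveals its lender, the cyclic successor; mutual borrowing
        would make \<open>i\<close> and \<open>j\<close> successors of each other.\<close>
      have "j = (if i + 1 < n then i + 1 else 0)" if "p i \<in> {2 * j + 1, 2 * j + 2}" for i j
        using that by (auto simp: p_def split: if_splits; presburger)
      from this[OF that(4)] this[of j i] show ?thesis
        using assms that(1-3) by (auto split: if_splits)
    qed
  qed (use assms in auto)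
next
  fix k c assume "edge_locating_coloring (windmill n) k c"
  then have "proper_edge_coloring (windmill n) k c"
    by (simp add: edge_locating_coloring_def)
  then show "2 * n \<le> k"
    using degree_le_colors[OF _ windmill_hub_neighbors(1)] windmill_hub_neighbors(2) by metis
qed

lemma windmill_two_number: "edge_locating_chromatic_number (windmill 2) = enat 5"
proof (rule edge_locating_chromatic_number_eqI)
  show "\<exists>c. edge_locating_coloring (windmill 2) 5 c"
    \<comment> \<open>Blade 0 takes the fifth color, which is on no spoke, so the borrowing by blade
      1 from blade 0 is not mutual.\<close>
    by (rule windmill_coloring_exists[where p = "\<lambda>i. if i = 0 then 5 else 1"])
      (auto simp: less_2_cases_iff intro: exI[of _ 0])
next
  fix k c assume loc: "edge_locating_coloring (windmill 2) k c"
  then have proper: "proper_edge_coloring (windmill 2) k c"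
    by (simp add: edge_locating_coloring_def)
  have "4 \<le> k"
    using degree_le_colors[OF proper windmill_hub_neighbors(1)] windmill_hub_neighbors(2)[of 2]
    by simp
  moreover have "k \<noteq> 4"
  proof
    assume "k = 4"
    define S where "S = ({..<2} \<times> {..<2} :: (nat \<times> nat) set)"
    define spoke where "spoke q = c {Inl 0, Inr q}" for q
    define blade where "blade i = c {Inr (i, 0), Inr (i, 1)}" for i
    have S: "i < 2 \<and> s < 2 \<longleftrightarrow> (i, s) \<in> S" for i s
      by (auto simp: S_def)
    have hub: "Inr ` S \<subseteq> neighbors (windmill 2) (Inl 0)" "card (Inr ` S :: (nat + nat \<times> nat) set) = k"
      using windmill_hub_neighbors[of 2] \<open>k = 4\<close> by (simp_all add: S_def)
    have spokes: "{1..k} = spoke ` S" "{1..k} \<subseteq> colors_at (windmill 2) c (Inl 0)"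
      using full_degree_colors[OF proper hub] by (simp_all add: spoke_def image_image)
    have nbs: "neighbors (windmill 2) (Inr (i, s)) = {Inl 0, Inr (i, 1 - s)}" if "i < 2" "s < 2" for i s
      using that by (auto simp: windmill_def neighbors_simps less_2_cases_iff)
    have pairs: "\<exists>x y. e = {x, y}" if "e \<in> edges (windmill 2)" for e
      using edge_pairs_join[OF edge_pairs_basic(1) edge_pairs_blades that[unfolded windmill_def]] .
    have colors: "colors_at (windmill 2) c (Inr (i, s)) = {spoke (i, s), blade i}" if "i < 2" "s < 2" for i s
      by (subst colors_at_eq, erule pairs)
        (use that in \<open>auto simp: nbs spoke_def blade_def insert_commute less_2_cases_iff\<close>)
    \<comment> \<open>The four spokes exhaust the colors, so a blade shares its color with a spoke;
      by properness that spoke is not at its own ends, hence it belongs to the other blade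
      \<open>1 - i\<close>.\<close>
    have blade_opposite: "\<exists>s<2. blade i = spoke (1 - i, s)" if "i < 2" for i
    proof -
      have "blade i \<in> {1..k}"
        using colors_at_subset[OF proper, of "Inr (i, 0)"] colors[of i 0] that by simp
      then obtain j s where js: "j < 2" "s < 2" "blade i = spoke (j, s)"
        unfolding spokes(1) by (auto simp: S_def)
      have "inj_on (\<lambda>w. c {Inr (i, s), w}) {Inl 0, Inr (i, 1 - s)}"
        using neighbor_colors(1)[OF proper, of "{Inl 0, Inr (i, 1 - s)}" "Inr (i, s)"] nbs[OF that js(2)] by simp
      moreover have "c {Inr (i, s), Inr (i, 1 - s)} = blade i"
        using js(2) by (auto simp: blade_def less_2_cases_iff insert_commute)
      moreover have "c {Inr (i, s), Inl 0} = spoke (i, s)"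
        by (simp add: spoke_def insert_commute)
      ultimately have "blade i \<noteq> spoke (i, s)"
        by (auto dest: inj_onD)
      with js that have "j = 1 - i"
        by (auto simp: less_2_cases_iff)
      with js show ?thesis by blast
    qed
    \<comment> \<open>End \<open>t\<close> of blade 0 has the spoke colored like blade 1, and end
      \<open>s\<close> of blade 1 the spoke colored like blade 0, so both ends meet exactly the two
      blade colors.\<close>
    obtain s t where st: "s < 2" "blade 0 = spoke (1, s)" "t < 2" "blade 1 = spoke (0, t)"
      using blade_opposite[of 0] blade_opposite[of 1] by auto
    have "edge_color_code (windmill 2) k c (Inr (0, t)) = edge_color_code (windmill 2) k c (Inr (1, s))"
    proof (rule colors_at_eq_imp_code_eq[of "Inl 0"])
      show "colors_at (windmill 2) c (Inr (0, t)) = colors_at (windmill 2) c (Inr (1, s))"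
        using st by (simp add: colors insert_commute)
    qed (use st nbs spokes(2) in auto)
    moreover have "Inr (0, t) \<in> verts (windmill 2)" "Inr (1, s) \<in> verts (windmill 2)"
      using st by (auto simp: windmill_def)
    ultimately show False
      using loc by (auto simp: edge_locating_coloring_def dest: inj_onD)
  qed
  ultimately show "5 \<le> k" by simp
qed

text \<open>Both spine vertices have degree \<open>2 * n + 1\<close>, so that many colors would give
  both the zero code.\<close>

lemma book_number:
  assumes "n \<ge> 2"
  shows "edge_locating_chromatic_number (book n) = enat (2 * n + 2)"
proof (rule edge_locating_chromatic_number_eqI[OF book_coloring[OF assms]])
  fix k c assume loc: "edge_locating_coloring (book n) k c"
  define S :: "nat \<Rightarrow> (nat + nat \<times> nat) set" where
    "S a = insert (Inl (1 - a)) (Inr ` ({..<n} \<times> {..<2}))" for a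
  have sub: "S a \<subseteq> neighbors (book n) (Inl a)" if "a < 2" for a
    using that by (auto simp: S_def book_def neighbors_simps less_2_cases_iff)
  have card: "card (S a) = 2 * n + 1" for a
    by (auto simp: S_def card_insert_if card_image card_cartesian_product)
  have "Suc (2 * n + 1) \<le> k"
    by (rule two_vertices_of_degree[OF loc _ _ _ sub[of 0] sub[of 1] card card])
      (auto simp: book_def)
  then show "2 * n + 2 \<le> k" by simp
qed

theorem theorem18:
  "(\<forall>n::nat. n \<ge> 4 \<longrightarrow> edge_locating_chromatic_number (wheel n) = enat n) \<and>
   (\<forall>n::nat. n \<ge> 4 \<longrightarrow> edge_locating_chromatic_number (fan n) = enat n) \<and>
   edge_locating_chromatic_number (fan 2) = enat 3 \<and>
   edge_locating_chromatic_number (fan 3) = enat 4 \<and>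
   (\<forall>n::nat. n \<ge> 3 \<longrightarrow> edge_locating_chromatic_number (windmill n) = enat (2 * n)) \<and>
   edge_locating_chromatic_number (windmill 2) = enat 5 \<and>
   (\<forall>n::nat. n \<ge> 3 \<longrightarrow> edge_locating_chromatic_number (book n) = enat (2 * n + 2)) \<and>
   edge_locating_chromatic_number (book 2) = enat 6"
  using wheel_number fan_number small_fan_number[of 2] small_fan_number[of 3] windmill_number
    windmill_two_number book_number book_number[of 2]
  by simp

end
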